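(* Let $\mathcal{U},\mathcal{V}$ be linear subspaces of $\mathbb{R}^n$ with $\dim(\mathcal{U}\cap\mathcal{V})<\min(\dim\mathcal{U},\dim\mathcal{V})$, so that their Friedrichs angle $\theta_F$ is defined. Let $(x^k)_{k\ge0}$ be generated by the generalized alternating projections iteration $$x^{k+1}=(1-\alpha)x^k+\alpha P_{\mathcal{U}}^{\alpha_2}P_{\mathcal{V}}^{\alpha_1}x^k,$$ where the parameters $\alpha\in(0,1]$, $\alpha_1,\alpha_2\in(0,2]$ may be updated from one iteration to the next. For each $k$ put $y^k=P_{\mathcal{V}}^{\alpha_1}x^k$ and $z^k=P_{\mathcal{U}}P_{\mathcal{V}}^{\alpha_1}x^k$ (with the value of $\alpha_1$ used at iteration $k$), and define the estimate $\hat\theta^k\in[0,\pi/2]$ by $$\cos\hat\theta^k:=\frac{|\langle x^k-y^k,\;z^k-y^k\rangle|}{\|x^k-y^k\|\,\|z^k-y^k\|},$$ with $\cos\hat\theta^k:=0$ if $x^k=y^k$ or $z^k=y^k$. If $x^0\in\mathcal{U}+\mathcal{V}$, then $\hat\theta^k\ge\theta_F$ for all $k\ge0$.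
   Context: $P_{\mathcal{C}}$ denotes the orthogonal projection onto $\mathcal{C}$, and $P_{\mathcal{C}}^{\alpha}:=(1-\alpha)I+\alpha P_{\mathcal{C}}$ is the relaxed projection with relaxation parameter $\alpha$. Principal angles: for subspaces $\mathcal{U},\mathcal{V}\subseteq\mathbb{R}^n$ and $m=\min(\dim\mathcal{U},\dim\mathcal{V})$, the principal angles $\theta_k\in[0,\pi/2]$, $k=1,\dots,m$, are defined recursively by $\cos\theta_k:=\max\langle u_k,v_k\rangle$ over $u_k\in\mathcal{U}$, $v_k\in\mathcal{V}$ with $\|u_k\|=\|v_k\|=1$ and $\langle u_k,v_i\rangle=\langle u_i,v_k\rangle=0$ for $i=1,\dots,k-1$ (where $u_i,v_i$ are maximizers from the earlier steps). They satisfy $0\le\theta_1\le\dots\le\theta_m\le\pi/2$. The Friedrichs angle is $\theta_F:=\theta_{s+1}$ with $s=\dim(\mathcal{U}\cap\mathcal{V})$; it is the smallest non-zero principal angle. *)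

theory Defs
  imports "HOL-Analysis.Analysis"
begin

text \<open>For a nonempty closed convex set \<open>C\<close>, in particular for a linear subspace,
  the orthogonal projection onto \<open>C\<close> is the nearest-point map \<^const>\<open>closest_point\<close>.\<close>

definition relaxed_proj :: "'a::euclidean_space set \<Rightarrow> real \<Rightarrow> 'a \<Rightarrow> 'a" where
  "relaxed_proj C a x = (1 - a) *\<^sub>R x + a *\<^sub>R closest_point C x"

definition gap_step ::
  "'a::euclidean_space set \<Rightarrow> 'a set \<Rightarrow> real \<Rightarrow> real \<Rightarrow> real \<Rightarrow> 'a \<Rightarrow> 'a" where
  "gap_step U V a a1 a2 x =
     (1 - a) *\<^sub>R x + a *\<^sub>R relaxed_proj U a2 (relaxed_proj V a1 x)"

definition feasible_pair ::
  "'a::euclidean_space set \<Rightarrow> 'a set \<Rightarrow> (nat \<Rightarrow> 'a) \<Rightarrow> (nat \<Rightarrow> 'a) \<Rightarrow> nat \<Rightarrow> 'a \<Rightarrow> 'a \<Rightarrow> bool"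
where
  "feasible_pair U V u v k a b \<longleftrightarrow>
     a \<in> U \<and> b \<in> V \<and> norm a = 1 \<and> norm b = 1 \<and>
     (\<forall>i\<in>{1..<k}. a \<bullet> v i = 0 \<and> u i \<bullet> b = 0)"

text \<open>Indices are 1-based: \<open>(u i, v i)\<close> is a maximizer of step \<open>i\<close>, for \<open>i = 1, \<dots>, k\<close>, where
  each step is constrained by the maximizers chosen in the earlier ones.\<close>

definition principal_vectors ::
  "'a::euclidean_space set \<Rightarrow> 'a set \<Rightarrow> nat \<Rightarrow> (nat \<Rightarrow> 'a) \<Rightarrow> (nat \<Rightarrow> 'a) \<Rightarrow> bool" where
  "principal_vectors U V k u v \<longleftrightarrow>
     (\<forall>i\<in>{1..k}. feasible_pair U V u v i (u i) (v i) \<and>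
        (\<forall>a b. feasible_pair U V u v i a b \<longrightarrow> a \<bullet> b \<le> u i \<bullet> v i))"

text \<open>Meaningful for \<open>1 \<le> k \<le> min (dim U) (dim V)\<close>; maximizers then exist by compactness, and
  the angle does not depend on which ones are chosen.\<close>

definition principal_angle ::
  "'a::euclidean_space set \<Rightarrow> 'a set \<Rightarrow> nat \<Rightarrow> real" where
  "principal_angle U V k =
     (THE \<theta>. \<exists>u v. principal_vectors U V k u v \<and> \<theta> \<in> {0..pi/2} \<and> cos \<theta> = u k \<bullet> v k)"

definition friedrichs_angle :: "'a::euclidean_space set \<Rightarrow> 'a set \<Rightarrow> real" where
  "friedrichs_angle U V = principal_angle U V (dim (U \<inter> V) + 1)"

text \<open>By Cauchy--Schwarz the argument of \<^const>\<open>arccos\<close> below lies in \<open>[0, 1]\<close>, so the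
  estimate lies in \<open>[0, \<pi>/2]\<close>.\<close>

definition angle_estimate ::
  "'a::euclidean_space set \<Rightarrow> 'a set \<Rightarrow> real \<Rightarrow> 'a \<Rightarrow> real" where
  "angle_estimate U V a1 x =
     (let y = relaxed_proj V a1 x; z = closest_point U y
      in arccos (if x = y \<or> z = y then 0
                 else \<bar>(x - y) \<bullet> (z - y)\<bar> / (norm (x - y) * norm (z - y))))"

end

theory Submission
  imports Defs
begin

text \<open>
  Let \<open>W = U \<inter> V\<close>. The first \<open>dim W\<close> principal vectors of both spaces coincide and form an
  orthonormal basis of \<open>W\<close>, so \<open>c = cos \<theta>\<^sub>F\<close> is the maximum of \<open>a \<bullet> b\<close> over unit vectors
  \<open>a \<in> U\<close>, \<open>b \<in> V\<close> orthogonal to \<open>W\<close>. The iterates stay in \<open>U + V\<close>; hence \<open>x - y \<in> U + V\<close> is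
  orthogonal to \<open>V\<close>, while \<open>z - y\<close> is orthogonal to \<open>U\<close>. A vector \<open>a \<in> U + V\<close> orthogonal to \<open>V\<close> is
  \<open>u - P\<^sub>V u\<close> for some \<open>u \<in> U\<close> orthogonal to \<open>W\<close>, so \<open>\<parallel>P\<^sub>V u\<parallel> \<le> c \<parallel>u\<parallel>\<close> and
  \<open>(1 - c\<^sup>2) \<parallel>u\<parallel>\<^sup>2 \<le> \<parallel>a\<parallel>\<^sup>2 = P\<^sub>U a \<bullet> u\<close>. This gives \<open>\<parallel>a - P\<^sub>U a\<parallel> \<le> c \<parallel>a\<parallel>\<close>, and
  therefore \<open>\<bar>a \<bullet> b\<bar> \<le> c \<parallel>a\<parallel> \<parallel>b\<parallel>\<close> whenever \<open>b\<close> is orthogonal to \<open>U\<close>.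
\<close>

section \<open>Orthogonal projections onto subspaces\<close>

lemma closest_point_in_subspace:
  fixes U :: "'a::euclidean_space set"
  assumes "subspace U"
  shows "closest_point U y \<in> U"
  using assms closed_subspace closest_point_in_set subspace_0 by blast

lemma closest_point_subspace_orthogonal:
  fixes U :: "'a::euclidean_space set"
  assumes "subspace U" "u \<in> U"
  shows "(y - closest_point U y) \<bullet> u = 0"
proof -
  \<comment> \<open>The obtuse-angle inequality of the nearest point is tested along the whole line
    through it in direction \<open>u\<close>; the values \<open>t = 1\<close> and
    \<open>t = -1\<close> turn it into an equality.\<close>
  have "(y - closest_point U y) \<bullet> (t *\<^sub>R u) \<le> 0" for t
    using closest_point_dot[of U "closest_point U y + t *\<^sub>R u" y] assms
    by (simp add: closest_point_in_subspace closed_subspace subspace_imp_convex subspace_add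
        subspace_scale)
  from this[of 1] this[of "-1"] show ?thesis by simp
qed

lemma subspace_set_plus:
  assumes "subspace U" "subspace V"
  shows "subspace (U + V)"
proof -
  have "U + V = {x + y |x y. x \<in> U \<and> y \<in> V}" by (auto simp: set_plus_def)
  then show ?thesis using subspace_sums[OF assms] by simp
qed

section \<open>Inner products of vectors orthogonal to \<open>V\<close> and to
  \<open>U\<close>\<close>

lemma inner_le_of_orthogonal_complements:
  fixes U V :: "'a::euclidean_space set"
  assumes U: "subspace U" and V: "subspace V" and c: "c \<ge> 0"
    and le: "\<And>u v. \<lbrakk>u \<in> U; v \<in> V; \<And>w. w \<in> U \<inter> V \<Longrightarrow> u \<bullet> w = 0; \<And>w. w \<in> U \<inter> V \<Longrightarrow> v \<bullet> w = 0\<rbrakk>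
               \<Longrightarrow> u \<bullet> v \<le> c * (norm u * norm v)"
    and a: "a \<in> U + V" "\<And>v. v \<in> V \<Longrightarrow> a \<bullet> v = 0"
    and b: "\<And>u. u \<in> U \<Longrightarrow> b \<bullet> u = 0"
  shows "\<bar>a \<bullet> b\<bar> \<le> c * (norm a * norm b)"
proof -
  have W: "subspace (U \<inter> V)" using U V by (rule subspace_inter)
  obtain u0 v0 where uv: "u0 \<in> U" "v0 \<in> V" "a = u0 + v0"
    using a(1) by (auto elim: set_plus_elim)
  \<comment> \<open>Removing \<open>w\<close> makes \<open>u\<close> orthogonal to the intersection,
    as \<open>le\<close> requires, and changes \<open>u0\<close> only by a vector of
    \<open>V\<close>.\<close>
  define w where "w = closest_point (U \<inter> V) u0"
  define u where "u = u0 - w"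
  define q where "q = closest_point V u"
  define p where "p = closest_point U a"
  have w: "w \<in> U" "w \<in> V" using closest_point_in_subspace[OF W] by (auto simp: w_def)
  have u: "u \<in> U" using U uv w by (simp add: u_def subspace_diff)
  have uW: "u \<bullet> z = 0" if "z \<in> U \<inter> V" for z
    unfolding u_def w_def by (rule closest_point_subspace_orthogonal[OF W that])
  have q: "q \<in> V" "(u - q) \<bullet> z = 0" if "z \<in> V" for z
    using closest_point_in_subspace[OF V] closest_point_subspace_orthogonal[OF V that]
    by (auto simp: q_def)
  have qV: "q \<in> V" using closest_point_in_subspace[OF V] by (simp add: q_def)
  have p: "p \<in> U" "(a - p) \<bullet> z = 0" if "z \<in> U" for z
    using closest_point_in_subspace[OF U] closest_point_subspace_orthogonal[OF U that]
    by (auto simp: p_def)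
  have pU: "p \<in> U" using closest_point_in_subspace[OF U] by (simp add: p_def)
  \<comment> \<open>The difference equals \<open>v0 + w + q\<close>, so it lies in \<open>V\<close>;
    it is also orthogonal to \<open>V\<close> because \<open>a\<close> and \<open>u - q\<close> are.
    Hence it vanishes.\<close>
  have "a - (u - q) \<in> V"
    using V uv w qV by (simp add: u_def subspace_add subspace_diff algebra_simps)
  then have "(a - (u - q)) \<bullet> (a - (u - q)) = 0"
    using a(2) q(2) by (metis diff_self inner_diff_left)
  then have aq: "a = u - q" by simp
  \<comment> \<open>Since \<open>u\<close> and \<open>u - q\<close> are both orthogonal to the
    intersection, so is \<open>q\<close>, and \<open>le\<close> applies to the pair
    \<open>(u, q)\<close>.\<close>
  have "q \<bullet> z = 0" if "z \<in> U \<inter> V" for z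
    using q(2)[of z] uW[OF that] that by (simp add: inner_diff_left)
  then have uq: "u \<bullet> q \<le> c * (norm u * norm q)"
    using u qV uW by (intro le) auto
  have uq2: "u \<bullet> q = (norm q)\<^sup>2"
    using q(2)[OF qV] by (simp add: inner_diff_left power2_norm_eq_inner)
  have nq: "norm q \<le> c * norm u"
  proof (cases "q = 0")
    case False
    have "norm q * norm q \<le> (c * norm u) * norm q"
      using uq uq2 by (simp add: power2_eq_square mult_ac)
    then show ?thesis using False by (simp add: mult_le_cancel_right)
  qed (use c in simp)
  have au: "a \<bullet> u = (norm a)\<^sup>2"
    using a(2)[OF qV] by (simp add: aq power2_norm_eq_inner inner_diff_right)
  have "(norm a)\<^sup>2 = (norm u)\<^sup>2 - (norm q)\<^sup>2"
    using au uq2 by (simp add: aq inner_diff_left inner_diff_right inner_commute power2_norm_eq_inner)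
  moreover have "(norm q)\<^sup>2 \<le> c\<^sup>2 * (norm u)\<^sup>2"
    using nq by (metis norm_ge_zero power_mono power_mult_distrib)
  ultimately have na: "(1 - c\<^sup>2) * (norm u)\<^sup>2 \<le> (norm a)\<^sup>2"
    by (simp add: algebra_simps)
  have ap: "(norm (a - p))\<^sup>2 = (norm a)\<^sup>2 - (norm p)\<^sup>2"
    using p(2)[OF pU] by (simp add: power2_norm_eq_inner inner_diff_left inner_diff_right inner_commute)
  \<comment> \<open>If \<open>u = 0\<close>, then \<open>au\<close> gives \<open>a = 0\<close>.
    Otherwise Cauchy-Schwarz bounds the fourth power of \<open>norm a\<close> from above,
    \<open>na\<close> times the square of \<open>norm a\<close> bounds it from below, and the square
    of \<open>norm u\<close> cancels.\<close>
  have np: "(1 - c\<^sup>2) * (norm a)\<^sup>2 \<le> (norm p)\<^sup>2"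
  proof (cases "u = 0")
    case True
    then show ?thesis using au by simp
  next
    case False
    have "(norm a)\<^sup>2 = p \<bullet> u" using au p(2)[OF u] by (simp add: inner_diff_left)
    also have "\<dots> \<le> norm p * norm u" by (rule norm_cauchy_schwarz)
    finally have "((norm a)\<^sup>2)\<^sup>2 \<le> (norm p * norm u)\<^sup>2" by (rule power_mono) simp
    moreover have "((1 - c\<^sup>2) * (norm u)\<^sup>2) * (norm a)\<^sup>2 \<le> (norm a)\<^sup>2 * (norm a)\<^sup>2"
      using na by (intro mult_right_mono) auto
    ultimately have "((1 - c\<^sup>2) * (norm a)\<^sup>2) * (norm u)\<^sup>2 \<le> (norm p)\<^sup>2 * (norm u)\<^sup>2"
      by (simp add: power_mult_distrib power2_eq_square mult_ac)
    then show ?thesis using False by (simp add: mult_le_cancel_right)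
  qed
  have "(norm (a - p))\<^sup>2 \<le> (c * norm a)\<^sup>2"
    using ap np by (simp add: algebra_simps power_mult_distrib)
  then have nap: "norm (a - p) \<le> c * norm a"
    using c by (simp add: power2_le_iff_abs_le)
  have "\<bar>a \<bullet> b\<bar> = \<bar>(a - p) \<bullet> b\<bar>"
    using b[OF pU] by (simp add: inner_diff_left inner_commute[of p])
  also have "\<dots> \<le> norm (a - p) * norm b" by (rule Cauchy_Schwarz_ineq2)
  also have "\<dots> \<le> (c * norm a) * norm b" using nap by (simp add: mult_right_mono)
  finally show ?thesis by (simp add: mult_ac)
qed

section \<open>Principal vectors inside the intersection\<close>

text \<open>By strong induction the \<open>i - 1\<close> earlier pairs coincide and lie in the
  intersection, too few to span it. A unit vector \<open>w\<close> of the intersection orthogonal to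
  them makes \<open>(w, w)\<close> feasible with inner product 1, so the maximizing pair attains
  equality in Cauchy-Schwarz.\<close>

lemma principal_vectors_coincide:
  fixes U V :: "'a::euclidean_space set"
  assumes U: "subspace U" and V: "subspace V"
    and pv: "principal_vectors U V k u v"
    and "i \<in> {1..k}" "i \<le> dim (U \<inter> V)"
  shows "u i = v i"
  using assms(4,5)
proof (induction i rule: less_induct)
  case (less i)
  have fp: "feasible_pair U V u v j (u j) (v j)" if "j \<in> {1..k}" for j
    using pv that by (auto simp: principal_vectors_def)
  have W: "subspace (U \<inter> V)" using U V by (rule subspace_inter)
  define B where "B = u ` {1..<i}"
  have eq: "u j = v j" if "j \<in> {1..<i}" for j
    using less that by auto
  have BW: "B \<subseteq> U \<inter> V"
  proof
    fix z assume "z \<in> B"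
    then obtain j where j: "j \<in> {1..<i}" "z = u j" by (auto simp: B_def)
    then show "z \<in> U \<inter> V"
      using fp[of j] eq[OF j(1)] less.prems by (auto simp: feasible_pair_def)
  qed
  have "dim B \<le> card B" by (simp add: B_def dim_le_card')
  also have "\<dots> \<le> card {1..<i}" unfolding B_def by (rule card_image_le) simp
  also have "\<dots> < dim (U \<inter> V)" using less.prems by auto
  finally have "dim B < dim (U \<inter> V)" .
  then have "span B \<noteq> span (U \<inter> V)" by (metis dim_span less_irrefl)
  moreover have "span B \<subseteq> span (U \<inter> V)" by (rule span_mono[OF BW])
  ultimately have "span B \<subset> span (U \<inter> V)" by blast
  then obtain z where z: "z \<noteq> 0" "z \<in> span (U \<inter> V)" "\<And>y. y \<in> span B \<Longrightarrow> orthogonal z y"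
    using orthogonal_to_subspace_exists_gen by blast
  define w where "w = (1 / norm z) *\<^sub>R z"
  have "z \<in> U \<inter> V" using z(2) W by (simp add: span_eq_iff[THEN iffD2])
  then have w: "w \<in> U" "w \<in> V" "norm w = 1"
    using z(1) U V by (auto simp: w_def subspace_scale)
  have "w \<bullet> u j = 0" if "j \<in> {1..<i}" for j
    using z(3)[of "u j"] that by (auto simp: w_def B_def orthogonal_def span_base)
  then have "feasible_pair U V u v i w w"
    using w eq by (auto simp: feasible_pair_def inner_commute)
  then have "w \<bullet> w \<le> u i \<bullet> v i"
    using pv less.prems(1) by (auto simp: principal_vectors_def)
  moreover have n: "norm (u i) = 1" "norm (v i) = 1"
    using fp[OF less.prems(1)] by (auto simp: feasible_pair_def)
  ultimately have "1 \<le> u i \<bullet> v i" using w(3) by (simp add: norm_eq_1)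
  then have "(u i - v i) \<bullet> (u i - v i) \<le> 0"
    using n by (simp add: inner_diff_left inner_diff_right norm_eq_1 inner_commute)
  then show ?case by (metis eq_iff_diff_eq_0 inner_eq_zero_iff inner_ge_zero order_antisym)
qed

text \<open>Orthogonality is asked for \<open>i < j\<close> because each feasible pair is
  constrained only by the earlier ones.\<close>

lemma span_orthonormal_family:
  fixes W :: "'a::euclidean_space set"
  assumes W: "subspace W"
    and u: "\<And>i. i \<in> {1..dim W} \<Longrightarrow> u i \<in> W \<and> norm (u i) = 1"
    and orth: "\<And>i j. \<lbrakk>i \<in> {1..dim W}; j \<in> {1..dim W}; i < j\<rbrakk> \<Longrightarrow> u i \<bullet> u j = 0"
  shows "span (u ` {1..dim W}) = W"
proof -
  have orth': "u i \<bullet> u j = 0" if "i \<in> {1..dim W}" "j \<in> {1..dim W}" "i \<noteq> j" for i j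
    using that orth by (metis inner_commute linorder_neqE_nat)
  have inj: "inj_on u {1..dim W}"
  proof (rule inj_onI, rule ccontr)
    fix i j assume ij: "i \<in> {1..dim W}" "j \<in> {1..dim W}" "u i = u j" "i \<noteq> j"
    then have "u i \<bullet> u i = 0" using orth'[of i j] by simp
    then show False using u[OF ij(1)] by simp
  qed
  have "pairwise orthogonal (u ` {1..dim W})"
    unfolding pairwise_def orthogonal_def using orth' by blast
  moreover have "0 \<notin> u ` {1..dim W}" using u by force
  ultimately have ind: "independent (u ` {1..dim W})"
    by (rule pairwise_orthogonal_independent)
  have sub: "u ` {1..dim W} \<subseteq> W" using u by blast
  have "W \<subseteq> span (u ` {1..dim W})"
    by (rule card_ge_dim_independent[OF sub ind]) (simp only: card_image[OF inj] card_atLeastAtMost)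
  then show ?thesis using sub W by (simp add: span_minimal subset_antisym)
qed

text \<open>The first \<open>dim (U \<inter> V)\<close> vectors are an orthonormal basis of the
  intersection, so orthogonality to them is orthogonality to all of it. The feasible set of the
  Friedrichs step thus does not depend on which maximizers were chosen before.\<close>

lemma feasible_pair_past_intersection:
  fixes U V :: "'a::euclidean_space set"
  assumes U: "subspace U" and V: "subspace V"
    and fp: "\<And>i. i \<in> {1..dim (U \<inter> V)} \<Longrightarrow> feasible_pair U V u v i (u i) (v i)"
    and eq: "\<And>i. i \<in> {1..dim (U \<inter> V)} \<Longrightarrow> u i = v i"
  shows "feasible_pair U V u v (dim (U \<inter> V) + 1) a b \<longleftrightarrow>
    a \<in> U \<and> b \<in> V \<and> norm a = 1 \<and> norm b = 1 \<and> (\<forall>w\<in>U \<inter> V. a \<bullet> w = 0 \<and> b \<bullet> w = 0)"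
proof -
  let ?s = "dim (U \<inter> V)"
  have W: "subspace (U \<inter> V)" using U V by (rule subspace_inter)
  have uW: "u i \<in> U \<inter> V \<and> norm (u i) = 1" if "i \<in> {1..?s}" for i
    using fp[OF that] eq[OF that] by (auto simp: feasible_pair_def)
  have "span (u ` {1..?s}) = U \<inter> V"
  proof (rule span_orthonormal_family[OF W uW])
    fix i j assume ij: "i \<in> {1..?s}" "j \<in> {1..?s}" "i < j"
    then have "u i \<bullet> v j = 0" using fp[OF ij(2)] by (auto simp: feasible_pair_def)
    then show "u i \<bullet> u j = 0" using eq[OF ij(2)] by simp
  qed
  then have "(\<forall>i\<in>{1..?s}. y \<bullet> u i = 0) \<longleftrightarrow> (\<forall>w\<in>U \<inter> V. y \<bullet> w = 0)" for y
  proof -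
    assume sp: "span (u ` {1..?s}) = U \<inter> V"
    have "y \<bullet> w = 0" if *: "\<forall>i\<in>{1..?s}. y \<bullet> u i = 0" and "w \<in> U \<inter> V" for w
    proof -
      have "w \<in> span (u ` {1..?s})" using that sp by simp
      moreover have "orthogonal y z" if "z \<in> u ` {1..?s}" for z
        using * that by (auto simp: orthogonal_def)
      ultimately show ?thesis using orthogonal_to_span orthogonal_def by blast
    qed
    then show ?thesis using uW by blast
  qed
  note this[of a] this[of b]
  moreover have "{1..<?s + 1} = {1..?s}" by auto
  moreover have "(\<forall>i\<in>{1..?s}. a \<bullet> v i = 0 \<and> u i \<bullet> b = 0) \<longleftrightarrow>
      (\<forall>i\<in>{1..?s}. a \<bullet> u i = 0) \<and> (\<forall>i\<in>{1..?s}. b \<bullet> u i = 0)"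
    using eq by (auto simp: inner_commute)
  ultimately show ?thesis unfolding feasible_pair_def by auto
qed

section \<open>Variational description of the Friedrichs angle\<close>

lemma unit_vector_orthogonal_to_subspace:
  fixes U W :: "'a::euclidean_space set"
  assumes "subspace U" "W \<subseteq> U" "dim W < dim U"
  obtains a where "a \<in> U" "norm a = 1" "\<And>w. w \<in> W \<Longrightarrow> a \<bullet> w = 0"
proof -
  have "span W \<subset> span U"
    using span_mono[OF assms(2)] assms(3) by (metis dim_span less_irrefl psubsetI)
  then obtain z where z: "z \<noteq> 0" "z \<in> span U" "\<And>y. y \<in> span W \<Longrightarrow> orthogonal z y"
    using orthogonal_to_subspace_exists_gen by blast
  have "z \<in> U" using z(2) assms(1) by (simp add: span_eq_iff[THEN iffD2])
  then show ?thesis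
    using that[of "(1 / norm z) *\<^sub>R z"] z assms(1)
    by (auto simp: subspace_scale orthogonal_def span_base)
qed

lemma compact_unit_vectors_orthogonal:
  fixes U W :: "'a::euclidean_space set"
  assumes "subspace U"
  shows "compact {a \<in> U. norm a = 1 \<and> (\<forall>w\<in>W. a \<bullet> w = 0)}"
proof -
  have "{a \<in> U. norm a = 1 \<and> (\<forall>w\<in>W. a \<bullet> w = 0)} = sphere 0 1 \<inter> (U \<inter> (\<Inter>w\<in>W. {a. a \<bullet> w = 0}))"
    by auto
  moreover have "closed {a. a \<bullet> w = 0}" for w :: 'a
    by (intro closed_Collect_eq continuous_intros)
  ultimately show ?thesis
    using assms by (simp add: compact_Int_closed closed_Int closed_INT closed_subspace)
qed

text \<open>The cosine \<open>c\<close> is the maximum of the inner product over the compact set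
  \<open>A \<times> B\<close>. To evaluate the definite description, some principal vectors must
  exist and all of them must give the value \<open>c\<close>.\<close>

lemma friedrichs_angle_variational:
  fixes U V :: "'a::euclidean_space set"
  assumes U: "subspace U" and V: "subspace V"
    and dims: "dim (U \<inter> V) < min (dim U) (dim V)"
  obtains c where "0 \<le> c" "c \<le> 1" "friedrichs_angle U V = arccos c"
    "\<And>a b. \<lbrakk>a \<in> U; b \<in> V; norm a = 1; norm b = 1; \<And>w. w \<in> U \<inter> V \<Longrightarrow> a \<bullet> w = 0;
             \<And>w. w \<in> U \<inter> V \<Longrightarrow> b \<bullet> w = 0\<rbrakk> \<Longrightarrow> a \<bullet> b \<le> c"
proof -
  let ?s = "dim (U \<inter> V)"
  define A where "A = {a \<in> U. norm a = 1 \<and> (\<forall>w\<in>U \<inter> V. a \<bullet> w = 0)}"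
  define B where "B = {b \<in> V. norm b = 1 \<and> (\<forall>w\<in>U \<inter> V. b \<bullet> w = 0)}"
  have W: "subspace (U \<inter> V)" using U V by (rule subspace_inter)
  obtain a1 where "a1 \<in> U" "norm a1 = 1" "\<And>w. w \<in> U \<inter> V \<Longrightarrow> a1 \<bullet> w = 0"
    using unit_vector_orthogonal_to_subspace[OF U, of "U \<inter> V"] dims by auto
  then have "a1 \<in> A" by (simp add: A_def)
  moreover obtain b1 where "b1 \<in> V" "norm b1 = 1" "\<And>w. w \<in> U \<inter> V \<Longrightarrow> b1 \<bullet> w = 0"
    using unit_vector_orthogonal_to_subspace[OF V, of "U \<inter> V"] dims by auto
  then have "b1 \<in> B" by (simp add: B_def)
  ultimately have ne: "A \<times> B \<noteq> {}" by blast
  have "\<exists>m\<in>A \<times> B. \<forall>p\<in>A \<times> B. fst p \<bullet> snd p \<le> fst m \<bullet> snd m"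
  proof (rule continuous_attains_sup[OF _ ne])
    show "compact (A \<times> B)"
      unfolding A_def B_def by (intro compact_Times compact_unit_vectors_orthogonal U V)
    show "continuous_on (A \<times> B) (\<lambda>p. fst p \<bullet> snd p)" by (intro continuous_intros)
  qed
  then obtain m where m: "m \<in> A \<times> B" "\<And>p. p \<in> A \<times> B \<Longrightarrow> fst p \<bullet> snd p \<le> fst m \<bullet> snd m"
    by blast
  define a0 where "a0 = fst m"
  define b0 where "b0 = snd m"
  have ab: "a0 \<in> A" "b0 \<in> B" using m(1) by (auto simp: a0_def b0_def)
  have max: "a \<bullet> b \<le> a0 \<bullet> b0" if "a \<in> A" "b \<in> B" for a b
    using m(2)[of "(a, b)"] that by (simp add: a0_def b0_def)
  define c where "c = a0 \<bullet> b0"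
  \<comment> \<open>Since \<open>A\<close> is symmetric, the maximum is at least its own negative,
    hence nonnegative.\<close>
  have "- a0 \<in> A" using ab(1) U by (auto simp: A_def subspace_neg)
  then have c0: "0 \<le> c" using max[of "- a0" b0] ab by (simp add: c_def)
  have c1: "c \<le> 1"
    using norm_cauchy_schwarz[of a0 b0] ab by (simp add: c_def A_def B_def)
  have fpAB: "feasible_pair U V u v (?s + 1) a b \<longleftrightarrow> a \<in> A \<and> b \<in> B"
    if "\<And>i. i \<in> {1..?s} \<Longrightarrow> feasible_pair U V u v i (u i) (v i)"
      "\<And>i. i \<in> {1..?s} \<Longrightarrow> u i = v i" for u v a b
    using feasible_pair_past_intersection[OF U V that, of a b] by (auto simp: A_def B_def)
  have unique: "u (?s + 1) \<bullet> v (?s + 1) = c" if pv: "principal_vectors U V (?s + 1) u v" for u v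
  proof -
    have fp: "feasible_pair U V u v i (u i) (v i)" if "i \<in> {1..?s + 1}" for i
      using pv that by (auto simp: principal_vectors_def)
    have eq: "u i = v i" if "i \<in> {1..?s}" for i
      using principal_vectors_coincide[OF U V pv] that by auto
    have iff: "feasible_pair U V u v (?s + 1) a b \<longleftrightarrow> a \<in> A \<and> b \<in> B" for a b
      by (rule fpAB[OF fp eq]) auto
    have "u (?s + 1) \<in> A \<and> v (?s + 1) \<in> B" using fp[of "?s + 1"] iff by simp
    moreover have "a0 \<bullet> b0 \<le> u (?s + 1) \<bullet> v (?s + 1)"
      using pv iff[of a0 b0] ab by (auto simp: principal_vectors_def)
    ultimately show ?thesis using max c_def by (simp add: order_antisym)
  qed
  have exist: "\<exists>u v. principal_vectors U V (?s + 1) u v"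
  proof -
    \<comment> \<open>Witnesses: an enumerated orthonormal basis of the intersection serves as both
      sequences up to \<open>?s\<close>, followed by the maximizing pair \<open>(a0, b0)\<close> at
      index \<open>?s + 1\<close>.\<close>
    obtain E where E: "E \<subseteq> U \<inter> V" "pairwise orthogonal E" "\<And>x. x \<in> E \<Longrightarrow> norm x = 1"
      "independent E" "card E = ?s" "span E = U \<inter> V"
      using orthonormal_basis_subspace[OF W] by blast
    have "finite E" using E(4) by (rule independent_imp_finite)
    from ex_bij_betw_nat_finite_1[OF this] obtain h where h: "bij_betw h {1..?s} E"
      unfolding E(5) ..
    define u where "u = h(?s + 1 := a0)"
    define v where "v = h(?s + 1 := b0)"
    have hE: "h i \<in> E" if "i \<in> {1..?s}" for i using bij_betwE[OF h] that by simp
    have horth: "h i \<bullet> h j = 0" if "i \<in> {1..?s}" "j \<in> {1..?s}" "i \<noteq> j" for i j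
    proof -
      have "h i \<noteq> h j" using h that by (metis bij_betw_imp_inj_on inj_onD)
      then show ?thesis using E(2) hE that by (auto simp: pairwise_def orthogonal_def)
    qed
    have uh: "u i = h i" "v i = h i" if "i \<in> {1..?s}" for i
      using that by (auto simp: u_def v_def)
    have fp: "feasible_pair U V u v i (u i) (v i)" if i: "i \<in> {1..?s}" for i
      using hE[OF i] E(1,3) horth i by (auto simp: feasible_pair_def uh)
    have iff: "feasible_pair U V u v (?s + 1) a b \<longleftrightarrow> a \<in> A \<and> b \<in> B" for a b
      by (rule fpAB[OF fp]) (auto simp: uh)
    have "feasible_pair U V u v i (u i) (v i) \<and>
        (\<forall>a b. feasible_pair U V u v i a b \<longrightarrow> a \<bullet> b \<le> u i \<bullet> v i)" if "i \<in> {1..?s + 1}" for i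
    proof (cases "i = ?s + 1")
      case True
      then show ?thesis using iff ab max by (auto simp: u_def v_def)
    next
      case False
      then have i: "i \<in> {1..?s}" using that by auto
      \<comment> \<open>Equal unit vectors already attain the Cauchy-Schwarz bound 1.\<close>
      have "a \<bullet> b \<le> u i \<bullet> v i" if "feasible_pair U V u v i a b" for a b
      proof -
        have "u i \<bullet> v i = 1" using E(3)[OF hE[OF i]] by (simp add: uh[OF i] norm_eq_1)
        then show ?thesis
          using that norm_cauchy_schwarz[of a b] by (simp add: feasible_pair_def)
      qed
      then show ?thesis using fp[OF i] by blast
    qed
    then show ?thesis unfolding principal_vectors_def by blast
  qed
  have "friedrichs_angle U V = arccos c"
    unfolding friedrichs_angle_def principal_angle_def
  proof (rule the_equality)
    show "\<exists>u v. principal_vectors U V (?s + 1) u v \<and> arccos c \<in> {0..pi/2} \<and>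
        cos (arccos c) = u (?s + 1) \<bullet> v (?s + 1)"
    proof -
      have "arccos c \<in> {0..pi/2}" "cos (arccos c) = c"
        using c0 c1 arccos_le_pi2[OF c0 c1] by (auto simp: arccos_lbound)
      then show ?thesis using exist unique by metis
    qed
  next
    fix \<theta> assume "\<exists>u v. principal_vectors U V (?s + 1) u v \<and> \<theta> \<in> {0..pi/2} \<and>
        cos \<theta> = u (?s + 1) \<bullet> v (?s + 1)"
    then have "\<theta> \<in> {0..pi/2}" "cos \<theta> = c" using unique by auto
    then show "\<theta> = arccos c" using arccos_cos[of \<theta>] pi_gt_zero by auto
  qed
  then show ?thesis
    using that[OF c0 c1] max by (auto simp: A_def B_def c_def)
qed

section \<open>The angle estimate along the iteration\<close>

lemma inner_le_of_unit:
  fixes a b :: "'a::real_inner"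
  assumes "a \<noteq> 0" "b \<noteq> 0" "((1 / norm a) *\<^sub>R a) \<bullet> ((1 / norm b) *\<^sub>R b) \<le> c"
  shows "a \<bullet> b \<le> c * (norm a * norm b)"
  using assms by (simp add: field_simps)

lemma friedrichs_angle_le_angle_estimate:
  fixes U V :: "'a::euclidean_space set"
  assumes U: "subspace U" and V: "subspace V"
    and dims: "dim (U \<inter> V) < min (dim U) (dim V)"
    and x: "x \<in> U + V"
  shows "friedrichs_angle U V \<le> angle_estimate U V r x"
proof -
  obtain c where c: "0 \<le> c" "c \<le> 1" "friedrichs_angle U V = arccos c"
    and max: "\<And>a b. \<lbrakk>a \<in> U; b \<in> V; norm a = 1; norm b = 1; \<And>w. w \<in> U \<inter> V \<Longrightarrow> a \<bullet> w = 0;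
             \<And>w. w \<in> U \<inter> V \<Longrightarrow> b \<bullet> w = 0\<rbrakk> \<Longrightarrow> a \<bullet> b \<le> c"
    using friedrichs_angle_variational[OF U V dims] by blast
  define y where "y = relaxed_proj V r x"
  define z where "z = closest_point U y"
  have le: "u \<bullet> v \<le> c * (norm u * norm v)"
    if "u \<in> U" "v \<in> V" "\<And>w. w \<in> U \<inter> V \<Longrightarrow> u \<bullet> w = 0" "\<And>w. w \<in> U \<inter> V \<Longrightarrow> v \<bullet> w = 0" for u v
  proof (cases "u = 0 \<or> v = 0")
    case False
    then show ?thesis
      using that U V by (intro inner_le_of_unit max) (auto simp: subspace_scale)
  qed auto
  have S: "subspace (U + V)"
    using U V by (rule subspace_set_plus)
  have VS: "V \<subseteq> U + V" using subspace_0[OF U] by (force simp: set_plus_def)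
  \<comment> \<open>Relaxation only rescales the residual of the projection, so \<open>x - y\<close>
    stays orthogonal to \<open>V\<close>.\<close>
  have xy: "x - y = r *\<^sub>R (x - closest_point V x)"
    by (simp add: y_def relaxed_proj_def algebra_simps)
  have "x - y \<in> U + V"
    unfolding xy using S x VS closest_point_in_subspace[OF V]
    by (intro subspace_scale subspace_diff) auto
  moreover have "(x - y) \<bullet> v = 0" if "v \<in> V" for v
    using closest_point_subspace_orthogonal[OF V that] by (simp add: xy)
  moreover have "(z - y) \<bullet> u = 0" if "u \<in> U" for u
    using closest_point_subspace_orthogonal[OF U that, of y] by (simp add: z_def inner_diff_left)
  ultimately have "\<bar>(x - y) \<bullet> (z - y)\<bar> \<le> c * (norm (x - y) * norm (z - y))"
    using inner_le_of_orthogonal_complements[OF U V c(1) le] by blast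
  \<comment> \<open>The default value 0 in the degenerate cases is covered by
    \<open>0 \<le> c\<close>.\<close>
  then have "(if x = y \<or> z = y then 0
      else \<bar>(x - y) \<bullet> (z - y)\<bar> / (norm (x - y) * norm (z - y))) \<le> c"
    (is "?e \<le> c") using c(1) by (simp add: divide_le_eq)
  moreover have "0 \<le> ?e" by simp
  ultimately have "arccos c \<le> arccos ?e"
    using c(2) by (intro arccos_le_arccos) linarith+
  then show ?thesis
    using c(3) by (simp only: angle_estimate_def Let_def y_def z_def)
qed

lemma relaxed_proj_in_subspace:
  fixes U S :: "'a::euclidean_space set"
  assumes "subspace U" "subspace S" "U \<subseteq> S" "x \<in> S"
  shows "relaxed_proj U r x \<in> S"
  unfolding relaxed_proj_def using assms closest_point_in_subspace[OF assms(1)]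
  by (intro subspace_add subspace_scale) auto

theorem theorem4:
  fixes U V :: "(real ^ 'n) set"
    and x :: "nat \<Rightarrow> real ^ 'n"
    and \<alpha> \<alpha>1 \<alpha>2 :: "nat \<Rightarrow> real"
  assumes "subspace U" and "subspace V"
    and "dim (U \<inter> V) < min (dim U) (dim V)"
    and "\<And>k. \<alpha> k \<in> {0<..1}"
    and "\<And>k. \<alpha>1 k \<in> {0<..2}"
    and "\<And>k. \<alpha>2 k \<in> {0<..2}"
    and "\<And>k. x (Suc k) = gap_step U V (\<alpha> k) (\<alpha>1 k) (\<alpha>2 k) (x k)"
    and "x 0 \<in> U + V"
  shows "\<forall>k. angle_estimate U V (\<alpha>1 k) (x k) \<ge> friedrichs_angle U V"
proof -
  have S: "subspace (U + V)" using assms(1,2) by (rule subspace_set_plus)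
  have sub: "U \<subseteq> U + V" "V \<subseteq> U + V"
    using subspace_0[OF assms(1)] subspace_0[OF assms(2)] by (force simp: set_plus_def)+
  \<comment> \<open>Invariance: projections onto \<open>U\<close> and \<open>V\<close> land in
    \<open>U + V\<close>, and each iteration only forms linear combinations of such points with the
    current one.\<close>
  have "x k \<in> U + V" for k
  proof (induction k)
    case (Suc k)
    then show ?case
      unfolding assms(7) gap_step_def using S sub assms(1,2)
      by (intro subspace_add subspace_scale relaxed_proj_in_subspace) auto
  qed (rule assms(8))
  then show ?thesis
    using friedrichs_angle_le_angle_estimate[OF assms(1-3)] by blast
qed

end
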